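(* For a Hausdorff semitopological semilattice $X$, consider the following conditions: (1) $X$ is $1$-Lawson; (2) $X$ is Lawson; (3) $X$ is a $V$-semilattice; (4) $X$ is $\mathbb I$-separated. Any of the conditions (2), (3), (4) implies (1). If the space $X$ is compact, then the conditions (1)--(4) are equivalent.
   Context: A semilattice is a commutative semigroup all of whose elements are idempotents. It carries the natural partial order $x\le y$ iff $xy=x$; for a point $x\in X$ put ${\uparrow}x=\{y\in X:xy=x\}$ and ${\downarrow}x=\{y\in X:xy=y\}$. A topologized semilattice is a semilattice endowed with a topology; it is semitopological if its operation $(x,y)\mapsto xy$ is separately continuous. A (closed) neighborhood of $x$ is a (closed) set containing $x$ in its interior. The Lawson number $\bar\Lambda(X)$ of a Hausdorff topologized semilattice $X$ is the smallest cardinal $\kappa$ such that for any distinct points $x,y\in X$ there exists a family $\mathcal U$ of closed neighborhoods of $x$ such that $|\mathcal U|\le\kappa$ and $\bigcap\mathcal U$ is a subsemilattice of $X$ that does not contain $y$ (with the convention $\bigcap\emptyset=X$). For a cardinal $\kappa$, a topologized semilattice $X$ is $\kappa$-Lawson if $X$ is Hausdorff and $\bar\Lambda(X)\le\kappa$. A topologized semilattice $X$ is: Lawson if it has a base of the topology consisting of open subsemilattices; a $V$-semilattice if for any point $x\in X$ and any $y\in X\setminus{\uparrow}x$ there exists a point $v\in X\setminus{\downarrow}y$ such that ${\uparrow}v$ is a neighborhood of $x$ in $X$; $\mathbb I$-separated if for any distinct points $x,y\in X$ there exists a continuous homomorphism $f:X\to\mathbb I$ with $f(x)\ne f(y)$,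 where $\mathbb I=[0,1]$ is the unit interval with its usual topology and the semilattice operation $\min$. *)

theory Defs
  imports "HOL-Analysis.Analysis"
begin

unbundle cardinal_syntax

text \<open>
  A topologized semilattice is a topological type \<open>'a\<close> with an operation \<open>m\<close> satisfying the library
  locale \<^locale>\<open>semilattice\<close> (commutative, associative, idempotent). The order is the meet order:
  \<open>x \<le> y\<close> iff \<open>m x y = x\<close>.
\<close>

definition semitopological_semilattice :: "('a::topological_space \<Rightarrow> 'a \<Rightarrow> 'a) \<Rightarrow> bool" where
  "semitopological_semilattice m \<longleftrightarrow>
     semilattice m \<and>
     (\<forall>a. continuous_on UNIV (\<lambda>x. m a x)) \<and> (\<forall>a. continuous_on UNIV (\<lambda>x. m x a))"

definition upper_set :: "('a \<Rightarrow> 'a \<Rightarrow> 'a) \<Rightarrow> 'a \<Rightarrow> 'a set" where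
  "upper_set m x = {y. m x y = x}"

definition lower_set :: "('a \<Rightarrow> 'a \<Rightarrow> 'a) \<Rightarrow> 'a \<Rightarrow> 'a set" where
  "lower_set m x = {y. m x y = y}"

definition subsemilattice :: "('a \<Rightarrow> 'a \<Rightarrow> 'a) \<Rightarrow> 'a set \<Rightarrow> bool" where
  "subsemilattice m S \<longleftrightarrow> (\<forall>a\<in>S. \<forall>b\<in>S. m a b \<in> S)"

definition nbhd :: "'a::topological_space \<Rightarrow> 'a set \<Rightarrow> bool" where
  "nbhd x N \<longleftrightarrow> x \<in> interior N"

text \<open>
  Cardinals are the cardinal orders of the library, taken up to \<open>=o\<close>.
\<close>

definition Lawson_bound :: "('a::topological_space \<Rightarrow> 'a \<Rightarrow> 'a) \<Rightarrow> 'k rel \<Rightarrow> bool" where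
  "Lawson_bound m \<kappa> \<longleftrightarrow>
     (\<forall>x y. x \<noteq> y \<longrightarrow>
        (\<exists>\<U>. (\<forall>N\<in>\<U>. closed N \<and> nbhd x N) \<and> |\<U>| \<le>o \<kappa> \<and>
             subsemilattice m (\<Inter>\<U>) \<and> y \<notin> \<Inter>\<U>))"

text \<open>
  The minimum is taken over cardinals living on the type \<open>'a set\<close>. A family \<open>\<U>\<close> as above has
  type \<open>'a set set\<close>, so no larger cardinal matters; \<open>Lawson_number_least\<close> below shows that the
  minimum exists and is minimal among cardinals of every type.
\<close>

definition Lawson_number :: "('a::t2_space \<Rightarrow> 'a \<Rightarrow> 'a) \<Rightarrow> 'a set rel" where
  "Lawson_number m =
     (SOME \<kappa>. Card_order \<kappa> \<and> Lawson_bound m \<kappa> \<and>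
        (\<forall>\<mu> :: 'a set rel. Card_order \<mu> \<and> Lawson_bound m \<mu> \<longrightarrow> \<kappa> \<le>o \<mu>))"

definition kappa_Lawson :: "('a::t2_space \<Rightarrow> 'a \<Rightarrow> 'a) \<Rightarrow> 'k rel \<Rightarrow> bool" where
  "kappa_Lawson m \<kappa> \<longleftrightarrow> Lawson_number m \<le>o \<kappa>"

definition Lawson_semilattice :: "('a::topological_space \<Rightarrow> 'a \<Rightarrow> 'a) \<Rightarrow> bool" where
  "Lawson_semilattice m \<longleftrightarrow>
     (\<exists>\<B>. topological_basis \<B> \<and> (\<forall>B\<in>\<B>. subsemilattice m B))"

definition V_semilattice :: "('a::topological_space \<Rightarrow> 'a \<Rightarrow> 'a) \<Rightarrow> bool" where
  "V_semilattice m \<longleftrightarrow>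
     (\<forall>x. \<forall>y\<in>UNIV - upper_set m x. \<exists>v\<in>UNIV - lower_set m y. nbhd x (upper_set m v))"

definition I_separated :: "('a::topological_space \<Rightarrow> 'a \<Rightarrow> 'a) \<Rightarrow> bool" where
  "I_separated m \<longleftrightarrow>
     (\<forall>x y. x \<noteq> y \<longrightarrow>
        (\<exists>f :: 'a \<Rightarrow> real. continuous_on UNIV f \<and> range f \<subseteq> {0..1} \<and>
             (\<forall>a b. f (m a b) = min (f a) (f b)) \<and> f x \<noteq> f y))"

lemma Lawson_bound_mono:
  fixes m :: "'a::topological_space \<Rightarrow> 'a \<Rightarrow> 'a"
  assumes "Lawson_bound m \<kappa>" "\<kappa> \<le>o \<mu>"
  shows "Lawson_bound m \<mu>"
  unfolding Lawson_bound_def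
proof (intro allI impI)
  fix x y :: 'a
  assume "x \<noteq> y"
  then obtain \<U> where "\<forall>N\<in>\<U>. closed N \<and> nbhd x N" "|\<U>| \<le>o \<kappa>"
      "subsemilattice m (\<Inter>\<U>)" "y \<notin> \<Inter>\<U>"
    using assms(1) unfolding Lawson_bound_def by metis
  then show "\<exists>\<U>. (\<forall>N\<in>\<U>. closed N \<and> nbhd x N) \<and> |\<U>| \<le>o \<mu> \<and>
      subsemilattice m (\<Inter>\<U>) \<and> y \<notin> \<Inter>\<U>"
    using ordLeq_transitive[OF _ assms(2)] by (intro exI[of _ \<U>] conjI)
qed

lemma Lawson_bound_UNIV:
  fixes m :: "'a::t2_space \<Rightarrow> 'a \<Rightarrow> 'a"
  assumes "semilattice m"
  shows "Lawson_bound m |UNIV :: 'a set set|"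
  unfolding Lawson_bound_def
proof (intro allI impI)
  fix x y :: 'a
  assume "x \<noteq> y"
  let ?U = "{N. closed N \<and> nbhd x N}"
  have only_x: "z \<notin> \<Inter>?U" if zx: "z \<noteq> x" for z
  proof -
    obtain S T where "open S" "open T" "x \<in> S" "z \<in> T" "S \<inter> T = {}"
      using hausdorff[OF zx[symmetric]] by blast
    then have "closed (- T)" "x \<in> interior (- T)"
      by (auto intro!: interiorI[of S])
    then show ?thesis
      using \<open>z \<in> T\<close> by (auto simp: nbhd_def)
  qed
  have "x \<in> \<Inter>?U"
    using interior_subset by (auto simp: nbhd_def)
  then have eq: "\<Inter>?U = {x}"
    using only_x by (intro equalityI subsetI) (metis singletonI, simp)
  have "m x x = x"
    using assms by (rule semilattice.idem)
  then have "subsemilattice m (\<Inter>?U)" "y \<notin> \<Inter>?U"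
    unfolding eq using \<open>x \<noteq> y\<close> by (auto simp: subsemilattice_def)
  moreover have "|?U| \<le>o |UNIV :: 'a set set|"
    by (rule card_of_mono1) (rule subset_UNIV)
  ultimately show "\<exists>\<U>. (\<forall>N\<in>\<U>. closed N \<and> nbhd x N) \<and> |\<U>| \<le>o |UNIV :: 'a set set| \<and>
      subsemilattice m (\<Inter>\<U>) \<and> y \<notin> \<Inter>\<U>"
    by (intro exI[of _ ?U] conjI) simp_all
qed

lemma Lawson_number_props:
  fixes m :: "'a::t2_space \<Rightarrow> 'a \<Rightarrow> 'a"
  assumes "semilattice m"
  shows "Card_order (Lawson_number m) \<and> Lawson_bound m (Lawson_number m) \<and>
    (\<forall>\<mu> :: 'a set rel. Card_order \<mu> \<and> Lawson_bound m \<mu> \<longrightarrow> Lawson_number m \<le>o \<mu>)"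
proof -
  let ?R = "{\<kappa> :: 'a set rel. Card_order \<kappa> \<and> Lawson_bound m \<kappa>}"
  have "?R \<noteq> {}"
    using Lawson_bound_UNIV[OF assms] card_of_Card_order by blast
  then have "\<exists>\<kappa>\<in>?R. \<forall>\<mu>\<in>?R. \<kappa> \<le>o \<mu>"
    by (intro exists_minim_Card_order) auto
  then have "\<exists>\<kappa> :: 'a set rel. Card_order \<kappa> \<and> Lawson_bound m \<kappa> \<and>
      (\<forall>\<mu> :: 'a set rel. Card_order \<mu> \<and> Lawson_bound m \<mu> \<longrightarrow> \<kappa> \<le>o \<mu>)"
    by blast
  then show ?thesis
    unfolding Lawson_number_def by (rule someI_ex)
qed

lemma Lawson_number_least:
  fixes m :: "'a::t2_space \<Rightarrow> 'a \<Rightarrow> 'a" and \<mu> :: "'k rel"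
  assumes "semilattice m" "Card_order \<mu>" "Lawson_bound m \<mu>"
  shows "Lawson_number m \<le>o \<mu>"
proof (cases "|Field \<mu>| \<le>o |UNIV :: 'a set set|")
  case True
  then obtain B :: "'a set set" where B: "( |Field \<mu>|, |B| ) \<in> ordIso"
    unfolding internalize_card_of_ordLeq2[of "Field \<mu>"] by (elim exE conjE)
  have \<mu>: "( |Field \<mu>|, \<mu> ) \<in> ordIso"
    using assms(2) by (rule card_of_Field_ordIso)
  have \<mu>B: "(\<mu>, |B| ) \<in> ordIso"
    using ordIso_transitive[OF ordIso_symmetric[OF \<mu>] B] .
  then have "Lawson_bound m |B|"
    using Lawson_bound_mono[OF assms(3)] ordIso_imp_ordLeq by metis
  then have "Lawson_number m \<le>o |B|"
    using Lawson_number_props[OF assms(1)] card_of_Card_order by blast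
  then show ?thesis
    by (rule ordLeq_ordIso_trans) (rule ordIso_symmetric[OF \<mu>B])
next
  case False
  then have "|UNIV :: 'a set set| \<le>o |Field \<mu>|"
    using ordLeq_total[OF card_of_Well_order[of "Field \<mu>"] card_of_Well_order[of "UNIV :: 'a set set"]]
    by simp
  then have "|UNIV :: 'a set set| \<le>o \<mu>"
    by (rule ordLeq_ordIso_trans) (rule card_of_Field_ordIso[OF assms(2)])
  moreover have "Lawson_number m \<le>o |UNIV :: 'a set set|"
    using Lawson_number_props[OF assms(1)] Lawson_bound_UNIV[OF assms(1)] card_of_Card_order
    by blast
  ultimately show ?thesis
    using ordLeq_transitive by blast
qed

lemma kappa_Lawson_iff:
  fixes m :: "'a::t2_space \<Rightarrow> 'a \<Rightarrow> 'a"
  assumes "semilattice m" "Card_order \<kappa>"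
  shows "kappa_Lawson m \<kappa> \<longleftrightarrow> Lawson_bound m \<kappa>"
  unfolding kappa_Lawson_def
proof
  assume "Lawson_number m \<le>o \<kappa>"
  then show "Lawson_bound m \<kappa>"
    by (rule Lawson_bound_mono[OF conjunct1[OF conjunct2[OF Lawson_number_props[OF assms(1)]]]])
next
  assume "Lawson_bound m \<kappa>"
  then show "Lawson_number m \<le>o \<kappa>"
    by (rule Lawson_number_least[OF assms])
qed

end

theory Submission
  imports Defs
begin

text \<open>
  A space is \<open>1\<close>-Lawson iff distinct points \<open>x\<close>, \<open>y\<close> can be separated by a single closed
  subsemilattice that is a neighborhood of \<open>x\<close> and misses \<open>y\<close> (the empty family cannot exclude
  \<open>y\<close>). Separate continuity is enough to make closures of subsemilattices subsemilattices and
  to make the sets \<open>\<up>v\<close> closed, and this yields such separating sets from each of the three other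
  conditions: closures of basic open subsemilattices in the Lawson case, closures of preimages of
  half-lines in the case of separation by homomorphisms into \<open>[0,1]\<close>. In a \<open>V\<close>-semilattice, if
  \<open>x \<le> y\<close> fails then some \<open>\<up>v\<close> is a neighborhood of \<open>x\<close> missing \<open>y\<close>; if \<open>x < y\<close> then one finds \<open>\<up>v\<close> around
  \<open>y\<close> missing \<open>x\<close>, and the complement of \<open>\<up>v\<close> is an open lower set, hence an open subsemilattice
  containing \<open>x\<close>, whose closure misses \<open>y\<close>.

  Now let the space be compact and \<open>1\<close>-Lawson. Finitely many separating sets cut a neighborhood
  of \<open>x\<close> down into any prescribed open set \<open>U\<close>, so that \<open>U\<close> contains a compact subsemilattice that is a
  neighborhood of \<open>x\<close>. A compact subsemilattice has a least element \<open>v\<close>. Writing \<open>v \<lless> x\<close> when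
  \<open>\<up>v\<close> is a neighborhood of \<open>x\<close>, this says that every open \<open>U\<close> around \<open>x\<close> contains some \<open>v \<lless> x\<close>
  (lemma \<open>locally_minorized_if_compact\<close>). Everything else follows from this property. With \<open>U\<close> the
  complement of \<open>\<down>y\<close> it is the \<open>V\<close>-property. With \<open>U\<close> the interior of \<open>\<up>u\<close> it says that the relation
  \<open>\<lless>\<close> interpolates, and then Urysohn's construction works with points in place of open sets: from
  \<open>v \<lless> x\<close> one obtains points \<open>v\<^sub>q\<close>, indexed by the dyadic rationals \<open>q\<close> of the unit interval, with
  \<open>v\<^sub>q \<lless> v\<^sub>r\<close> for \<open>q < r\<close>, and \<open>f z = sup {q. v\<^sub>q \<le> z}\<close> is continuous. It is a homomorphism because
  the sets \<open>\<up>v\<^sub>q\<close> are filters. Finally, preimages of open half-lines are open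
  subsemilattices that separate points, and the same compactness argument as above produces a
  base of them.
\<close>

section \<open>Separately continuous semilattices\<close>

locale separately_continuous_semilattice = semilattice m
  for m :: "'a::t2_space \<Rightarrow> 'a \<Rightarrow> 'a" +
  assumes continuous_translation: "continuous_on UNIV (m a)"
begin

lemma upper_set_mult_iff: "m a b \<in> upper_set m v \<longleftrightarrow> a \<in> upper_set m v \<and> b \<in> upper_set m v"
  unfolding upper_set_def mem_Collect_eq by (metis assoc commute idem)

lemma self_in_upper_set: "v \<in> upper_set m v"
  by (simp add: upper_set_def)

lemma upper_set_antimono: "w \<in> upper_set m v \<Longrightarrow> upper_set m w \<subseteq> upper_set m v"
  unfolding upper_set_def by (auto, metis assoc)

lemma in_upper_set_iff_in_lower_set: "y \<in> upper_set m v \<longleftrightarrow> v \<in> lower_set m y"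
  unfolding upper_set_def lower_set_def mem_Collect_eq by (metis commute)

lemma upper_set_antisym: "x \<in> upper_set m y \<Longrightarrow> y \<in> upper_set m x \<Longrightarrow> x = y"
  unfolding upper_set_def mem_Collect_eq by (metis commute)

lemma subsemilattice_upper_set: "subsemilattice m (upper_set m v)"
  by (simp add: subsemilattice_def upper_set_mult_iff)

text \<open>
  The complement of \<open>\<up>v\<close> is a lower set, so it absorbs products.
\<close>

lemma subsemilattice_Compl_upper_set: "subsemilattice m (- upper_set m v)"
  by (simp add: subsemilattice_def upper_set_mult_iff)

lemma closed_upper_set: "closed (upper_set m v)"
  unfolding upper_set_def
  by (intro closed_Collect_eq continuous_translation continuous_on_const)

lemma closed_lower_set: "closed (lower_set m y)"
  unfolding lower_set_def
  by (intro closed_Collect_eq continuous_translation continuous_on_id)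

text \<open>
  With separate continuity the two factors are moved to the closure one at a time.
\<close>

lemma subsemilattice_closure:
  assumes "subsemilattice m S"
  shows "subsemilattice m (closure S)"
proof -
  have extend: "m a b \<in> closure S"
    if "b \<in> closure S" and "\<And>c. c \<in> S \<Longrightarrow> m a c \<in> closure S" for a b
  proof -
    have "m a ` closure S \<subseteq> closure S"
      by (rule image_closure_subset)
        (use that continuous_on_subset[OF continuous_translation] in auto)
    with that(1) show ?thesis by blast
  qed
  have left: "m a b \<in> closure S" if "a \<in> S" "b \<in> closure S" for a b
  proof (rule extend[OF that(2)])
    show "m a c \<in> closure S" if "c \<in> S" for c
      using assms \<open>a \<in> S\<close> that closure_subset[of S] by (auto simp: subsemilattice_def)
  qed
  have "m a b \<in> closure S" if "a \<in> closure S" "b \<in> closure S" for a b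
  proof (rule extend[OF that(2)])
    show "m a c \<in> closure S" if "c \<in> S" for c
      using left[OF that \<open>a \<in> closure S\<close>] by (simp only: commute[of a c])
  qed
  then show ?thesis by (simp add: subsemilattice_def)
qed

section \<open>The one-Lawson property as separation by closed subsemilattices\<close>

lemma one_Lawson_iff:
  "kappa_Lawson m |{()}| \<longleftrightarrow>
    (\<forall>x y. x \<noteq> y \<longrightarrow> (\<exists>N. closed N \<and> nbhd x N \<and> subsemilattice m N \<and> y \<notin> N))"
    (is "_ \<longleftrightarrow> (\<forall>x y. x \<noteq> y \<longrightarrow> ?sep x y)")
proof -
  have card_le: "|\<U>| \<le>o |{()}| \<longleftrightarrow> \<U> = {} \<or> (\<exists>N. \<U> = {N})" for \<U> :: "'a set set"
  proof -
    have "|\<U>| \<le>o |{()}| \<longleftrightarrow> (\<exists>f. inj_on f \<U> \<and> f ` \<U> \<subseteq> {()})"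
      by (rule card_of_ordLeq[symmetric])
    also have "\<dots> \<longleftrightarrow> (\<forall>M\<in>\<U>. \<forall>N\<in>\<U>. M = N)"
      by (auto simp: inj_on_def)
    also have "\<dots> \<longleftrightarrow> \<U> = {} \<or> (\<exists>N. \<U> = {N})"
      by blast
    finally show ?thesis .
  qed
  have sep_iff: "(\<exists>\<U>. (\<forall>N\<in>\<U>. closed N \<and> nbhd x N) \<and> |\<U>| \<le>o |{()}| \<and>
      subsemilattice m (\<Inter>\<U>) \<and> y \<notin> \<Inter>\<U>) \<longleftrightarrow> ?sep x y" for x y
  proof
    assume "?sep x y"
    then obtain N where "closed N" "nbhd x N" "subsemilattice m N" "y \<notin> N"
      by blast
    then show "\<exists>\<U>. (\<forall>N\<in>\<U>. closed N \<and> nbhd x N) \<and> |\<U>| \<le>o |{()}| \<and>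
        subsemilattice m (\<Inter>\<U>) \<and> y \<notin> \<Inter>\<U>"
      by (intro exI[of _ "{N}"]) (simp add: card_le)
  next
    assume "\<exists>\<U>. (\<forall>N\<in>\<U>. closed N \<and> nbhd x N) \<and> |\<U>| \<le>o |{()}| \<and>
        subsemilattice m (\<Inter>\<U>) \<and> y \<notin> \<Inter>\<U>"
    then show "?sep x y"
      unfolding card_le by (elim exE conjE disjE) auto
  qed
  have "Lawson_bound m |{()}| \<longleftrightarrow> (\<forall>x y. x \<noteq> y \<longrightarrow> ?sep x y)"
    unfolding Lawson_bound_def sep_iff ..
  then show ?thesis
    by (simp add: kappa_Lawson_iff[OF semilattice_axioms card_of_Card_order])
qed

lemma closed_nbhd_of_open_subsemilattice:
  assumes "open W" "subsemilattice m W" "x \<in> W" "y \<notin> closure W"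
  shows "\<exists>N. closed N \<and> nbhd x N \<and> subsemilattice m N \<and> y \<notin> N"
proof (intro exI conjI)
  show "closed (closure W)"
    by (rule closed_closure)
  show "nbhd x (closure W)"
    unfolding nbhd_def using assms(1,3) closure_subset by (rule interiorI)
  show "subsemilattice m (closure W)"
    using assms(2) by (rule subsemilattice_closure)
  show "y \<notin> closure W"
    by (rule assms(4))
qed

lemma Lawson_imp_one_Lawson:
  assumes "Lawson_semilattice m"
  shows "kappa_Lawson m |{()}|"
  unfolding one_Lawson_iff
proof (intro allI impI)
  fix x y :: 'a
  assume "x \<noteq> y"
  then obtain S T where ST: "open S" "open T" "x \<in> S" "y \<in> T" "S \<inter> T = {}"
    using hausdorff[of x y] by auto
  obtain B where B: "topological_basis B" "\<forall>W\<in>B. subsemilattice m W"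
    using assms unfolding Lawson_semilattice_def by blast
  obtain W where "W \<in> B" "x \<in> W" "W \<subseteq> S"
    using B(1) ST(1,3) by (rule topological_basisE)
  with B have W: "open W" "subsemilattice m W" "x \<in> W" "W \<subseteq> S"
    using topological_basis_open by auto
  have "y \<notin> closure W"
    using W ST open_Int_closure_eq_empty[of T W] by blast
  with W show "\<exists>N. closed N \<and> nbhd x N \<and> subsemilattice m N \<and> y \<notin> N"
    by (intro closed_nbhd_of_open_subsemilattice)
qed

lemma V_imp_one_Lawson:
  assumes "V_semilattice m"
  shows "kappa_Lawson m |{()}|"
  unfolding one_Lawson_iff
proof (intro allI impI)
  fix x y :: 'a
  assume "x \<noteq> y"
  have V: "\<exists>v. nbhd a (upper_set m v) \<and> b \<notin> upper_set m v" if "b \<notin> upper_set m a" for a b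
  proof -
    have "\<exists>v\<in>UNIV - lower_set m b. nbhd a (upper_set m v)"
      using assms that by (simp add: V_semilattice_def)
    then show ?thesis
      unfolding in_upper_set_iff_in_lower_set by blast
  qed
  show "\<exists>N. closed N \<and> nbhd x N \<and> subsemilattice m N \<and> y \<notin> N"
  proof (cases "y \<in> upper_set m x")
    case False
    with V show ?thesis
      using closed_upper_set subsemilattice_upper_set by metis
  next
    case True
    with \<open>x \<noteq> y\<close> have "x \<notin> upper_set m y"
      using upper_set_antisym by blast
    then obtain v where v: "nbhd y (upper_set m v)" "x \<notin> upper_set m v"
      using V by blast
    show ?thesis
    proof (rule closed_nbhd_of_open_subsemilattice)
      show "open (- upper_set m v)"
        using closed_upper_set by (simp add: open_Compl)
      show "y \<notin> closure (- upper_set m v)"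
        using v by (simp add: nbhd_def closure_complement)
    qed (use v subsemilattice_Compl_upper_set in auto)
  qed
qed

text \<open>
  The separating sets are preimages of the half-lines ending at the midpoint of \<open>f x\<close> and \<open>f y\<close>.
\<close>

lemma I_separated_open_subsemilattice:
  assumes "I_separated m" "x \<noteq> y"
  shows "\<exists>W. open W \<and> subsemilattice m W \<and> x \<in> W \<and> y \<notin> closure W"
proof -
  obtain f :: "'a \<Rightarrow> real" where f: "continuous_on UNIV f"
      "\<And>a b. f (m a b) = min (f a) (f b)" "f x \<noteq> f y"
    using assms unfolding I_separated_def by metis
  define c where "c = (f x + f y) / 2"
  consider "f x < c" "c < f y" | "c < f x" "f y < c"
    using f(3) unfolding c_def by fastforce
  then show ?thesis
  proof cases
    case 1
    have "closure {z. f z < c} \<subseteq> {z. f z \<le> c}"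
      by (intro closure_minimal closed_Collect_le f continuous_on_const) auto
    moreover have "open {z. f z < c}"
      by (intro open_Collect_less f continuous_on_const)
    ultimately show ?thesis
      using 1 by (intro exI[of _ "{z. f z < c}"]) (auto simp: subsemilattice_def f(2))
  next
    case 2
    have "closure {z. c < f z} \<subseteq> {z. c \<le> f z}"
      by (intro closure_minimal closed_Collect_le f continuous_on_const) auto
    moreover have "open {z. c < f z}"
      by (intro open_Collect_less f continuous_on_const)
    ultimately show ?thesis
      using 2 by (intro exI[of _ "{z. c < f z}"]) (auto simp: subsemilattice_def f(2))
  qed
qed

lemma I_separated_imp_one_Lawson:
  assumes "I_separated m"
  shows "kappa_Lawson m |{()}|"
  unfolding one_Lawson_iff
  using I_separated_open_subsemilattice[OF assms] closed_nbhd_of_open_subsemilattice by metis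

end

section \<open>Compactness: small neighborhoods and least elements\<close>

text \<open>
  Compactness turns the separation of \<open>x\<close> from single points into smallness: the complements of
  the closures cover the compact set \<open>- U\<close>.
\<close>

lemma compact_separation_imp_small:
  fixes U :: "'a::topological_space set"
  assumes "compact (UNIV :: 'a set)" "open U"
    and UNIV: "P UNIV"
    and Int: "\<And>A B. P A \<Longrightarrow> P B \<Longrightarrow> P (A \<inter> B)"
    and sep: "\<And>y. y \<notin> U \<Longrightarrow> \<exists>W. P W \<and> y \<notin> closure W"
  shows "\<exists>W. P W \<and> W \<subseteq> U"
proof -
  obtain W where W: "\<And>y. y \<notin> U \<Longrightarrow> P (W y) \<and> y \<notin> closure (W y)"
    using sep by metis
  have "compact (- U)"
    using compact_Int_closed[OF assms(1), of "- U"] assms(2) by (simp add: closed_Compl)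
  moreover have "open (- closure (W y))" for y
    by (simp add: open_Compl)
  moreover have "- U \<subseteq> (\<Union>y\<in>- U. - closure (W y))"
    using W by blast
  ultimately obtain C where C: "C \<subseteq> - U" "finite C" "- U \<subseteq> (\<Union>y\<in>C. - closure (W y))"
    by (metis (lifting) compactE_image)
  have "P (\<Inter>y\<in>C. W y)"
    using C(2,1) by (induction C rule: finite_induct) (auto simp: UNIV intro!: Int dest: W)
  moreover have "(\<Inter>y\<in>C. W y) \<subseteq> U"
    using C(3) closure_subset by blast
  ultimately show ?thesis by blast
qed

context separately_continuous_semilattice
begin

text \<open>
  Finite products bound finite subsets from below inside \<open>N\<close>; the least element is the cluster
  point that compactness provides for this downward directed set.
\<close>

lemma compact_subsemilattice_has_least:
  assumes "compact N" "subsemilattice m N" "N \<noteq> {}"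
  shows "\<exists>v\<in>N. N \<subseteq> upper_set m v"
proof -
  have lower: "\<exists>a\<in>N. \<forall>b\<in>A. a \<in> lower_set m b" if "finite A" "A \<subseteq> N" for A
    using that
  proof (induction A rule: finite_induct)
    case empty
    with assms(3) show ?case by blast
  next
    case (insert b A)
    then obtain a where a: "a \<in> N" "\<forall>c\<in>A. a \<in> lower_set m c"
      by blast
    have "m b a \<in> N"
      using assms(2) a insert.prems by (simp add: subsemilattice_def)
    moreover have "m b a \<in> lower_set m c" if "c \<in> insert b A" for c
      using a(2) that unfolding lower_set_def mem_Collect_eq insert_iff
      by (metis left_idem left_commute)
    ultimately show ?case by blast
  qed
  have "N \<inter> \<Inter> (lower_set m ` N) \<noteq> {}"
  proof (rule compact_imp_fip[OF assms(1)])
    fix F'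
    assume "finite F'" "F' \<subseteq> lower_set m ` N"
    then obtain A where "A \<subseteq> N" "finite A" "F' = lower_set m ` A"
      by (metis finite_subset_image)
    then show "N \<inter> \<Inter> F' \<noteq> {}"
      using lower by fastforce
  qed (auto simp: closed_lower_set)
  then obtain v where "v \<in> N" "\<And>b. b \<in> N \<Longrightarrow> v \<in> lower_set m b"
    by blast
  then show ?thesis
    using in_upper_set_iff_in_lower_set by blast
qed

section \<open>The way-below relation and its interpolation\<close>

definition way_below :: "'a \<Rightarrow> 'a \<Rightarrow> bool"  (infix \<open>\<lless>\<close> 50)
  where "v \<lless> x \<longleftrightarrow> nbhd x (upper_set m v)"

text \<open>
  This is the form in which compactness enters the construction of homomorphisms. It is the analogue
  for semilattices of the statement that in a continuous lattice every element is approximated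
  from way below, with convergence taken in the given topology.
\<close>

definition locally_minorized :: bool
  where "locally_minorized \<longleftrightarrow> (\<forall>U x. open U \<longrightarrow> x \<in> U \<longrightarrow> (\<exists>v\<in>U. v \<lless> x))"

text \<open>
  The witness is the least element of a compact subsemilattice neighborhood of \<open>x\<close> inside \<open>U\<close>.
\<close>

lemma locally_minorized_if_compact:
  assumes "compact (UNIV :: 'a set)" "kappa_Lawson m |{()}|"
  shows locally_minorized
  unfolding locally_minorized_def
proof (intro allI impI)
  fix U and x :: 'a
  assume U: "open U" "x \<in> U"
  have "\<exists>N. (closed N \<and> nbhd x N \<and> subsemilattice m N) \<and> N \<subseteq> U"
  proof (rule compact_separation_imp_small[OF assms(1) U(1)])
    fix y
    assume "y \<notin> U"
    with U(2) have "x \<noteq> y" by blast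
    with assms(2) obtain N where "closed N \<and> nbhd x N \<and> subsemilattice m N" "y \<notin> N"
      unfolding one_Lawson_iff by metis
    then show "\<exists>N. (closed N \<and> nbhd x N \<and> subsemilattice m N) \<and> y \<notin> closure N"
      by (intro exI[of _ N]) auto
  qed (auto simp: nbhd_def subsemilattice_def)
  then obtain N where N: "closed N" "nbhd x N" "subsemilattice m N" "N \<subseteq> U"
    by blast
  have "compact N"
    using compact_Int_closed[OF assms(1) N(1)] by simp
  moreover have "N \<noteq> {}"
    using N(2) interior_subset by (auto simp: nbhd_def)
  ultimately obtain v where "v \<in> N" "N \<subseteq> upper_set m v"
    using compact_subsemilattice_has_least N(3) by blast
  then show "\<exists>v\<in>U. v \<lless> x"
    using N(2,4) interior_mono unfolding way_below_def nbhd_def by blast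
qed

text \<open>
  If \<open>u\<close> lies in the interior of \<open>\<up>v\<close>, then so does everything above \<open>u\<close>: the preimage of that
  interior under multiplication by \<open>u\<close> is open and contained in \<open>\<up>v\<close>.
\<close>

lemma way_below_upper_set_subset_interior:
  assumes "v \<lless> u"
  shows "upper_set m u \<subseteq> interior (upper_set m v)"
proof
  fix z
  assume "z \<in> upper_set m u"
  then have "m u z \<in> interior (upper_set m v)"
    using assms by (simp add: way_below_def nbhd_def upper_set_def)
  moreover have "open (m u -` interior (upper_set m v))"
    by (intro open_vimage continuous_translation open_interior)
  moreover have "m u -` interior (upper_set m v) \<subseteq> upper_set m v"
    using interior_subset upper_set_mult_iff by blast
  ultimately show "z \<in> interior (upper_set m v)"
    by (intro interiorI[of "m u -` interior (upper_set m v)"]) auto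
qed

lemma way_below_imp_in_upper_set: "v \<lless> u \<Longrightarrow> u \<in> upper_set m v"
  unfolding way_below_def nbhd_def using interior_subset by blast

lemma way_below_trans: "u \<lless> v \<Longrightarrow> v \<lless> x \<Longrightarrow> u \<lless> x"
  using way_below_upper_set_subset_interior way_below_imp_in_upper_set
  unfolding way_below_def nbhd_def by blast

text \<open>
  The interior of \<open>\<up>v\<close> is an open set around \<open>x\<close>, and any \<open>u \<lless> x\<close> inside it is an interpolant.
\<close>

lemma way_below_interpolate:
  assumes locally_minorized "v \<lless> x"
  shows "\<exists>u. v \<lless> u \<and> u \<lless> x"
  using assms unfolding locally_minorized_def way_below_def nbhd_def
  by (metis open_interior)

lemma separation_by_way_below:
  assumes locally_minorized "y \<notin> upper_set m x"
  shows "\<exists>v. v \<lless> x \<and> y \<notin> upper_set m v"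
proof -
  have "open (- lower_set m y)" "x \<in> - lower_set m y"
    using closed_lower_set assms(2) in_upper_set_iff_in_lower_set by (auto simp: open_Compl)
  then obtain v where "v \<in> - lower_set m y" "v \<lless> x"
    using assms(1) unfolding locally_minorized_def by blast
  then show ?thesis
    using in_upper_set_iff_in_lower_set by blast
qed

lemma locally_minorized_imp_V: "locally_minorized \<Longrightarrow> V_semilattice m"
  using separation_by_way_below in_upper_set_iff_in_lower_set
  unfolding V_semilattice_def way_below_def by (metis DiffD2 DiffI UNIV_I)

end

section \<open>Homomorphisms into the unit interval\<close>

text \<open>
  Urysohn's construction \<open>f z = sup {q. z \<in> F q}\<close>. For \<open>0 \<le> t \<le> 1\<close> the set \<open>{z. f z < t}\<close> is the union
  of the complements of the closed sets \<open>F q\<close> with \<open>q < t\<close>, and \<open>{z. t < f z}\<close> is the union of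
  the sets \<open>F r\<close> with \<open>r > t\<close>; the latter is open because density supplies \<open>q\<close> between \<open>t\<close> and \<open>r\<close>,
  and \<open>F r\<close> lies in the interior of \<open>F q\<close>. The map is a homomorphism because from \<open>a \<in> F q\<close> and
  \<open>b \<in> F r\<close> both points lie in the larger of the two filters, hence so does their product.
\<close>

lemma nested_filters_homomorphism:
  fixes F :: "real \<Rightarrow> 'a::topological_space set" and m :: "'a \<Rightarrow> 'a \<Rightarrow> 'a"
  assumes D: "D \<subseteq> {0..1}" "\<And>s t. 0 \<le> s \<Longrightarrow> s < t \<Longrightarrow> t \<le> 1 \<Longrightarrow> \<exists>q\<in>D. s < q \<and> q < t"
    and closed: "\<And>q. q \<in> D \<Longrightarrow> closed (F q)"
    and filter: "\<And>q a b. q \<in> D \<Longrightarrow> m a b \<in> F q \<longleftrightarrow> a \<in> F q \<and> b \<in> F q"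
    and nested: "\<And>q r. q \<in> D \<Longrightarrow> r \<in> D \<Longrightarrow> q < r \<Longrightarrow> F r \<subseteq> interior (F q)"
  obtains f :: "'a \<Rightarrow> real" where "continuous_on UNIV f" "range f \<subseteq> {0..1}"
    "\<And>a b. f (m a b) = min (f a) (f b)"
    "\<And>z. (\<And>q. q \<in> D \<Longrightarrow> z \<in> F q) \<Longrightarrow> f z = 1"
    "\<And>z. (\<And>q. q \<in> D \<Longrightarrow> z \<notin> F q) \<Longrightarrow> f z = 0"
proof -
  \<comment> \<open>Inserting \<open>0\<close> fixes the value at points that lie in no \<open>F q\<close>.\<close>
  define f where "f z = Sup (insert 0 {q \<in> D. z \<in> F q})" for z
  have bdd: "bdd_above (insert 0 {q \<in> D. z \<in> F q})" for z
    using D(1) by (intro bdd_aboveI[of _ 1]) auto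
  have mono: "F r \<subseteq> F q" if "q \<in> D" "r \<in> D" "q \<le> r" for q r
    using nested[OF that(1,2)] that(3) interior_subset[of "F q"] by (cases "q = r") auto
  have f_greater: "t < f z \<longleftrightarrow> t < 0 \<or> (\<exists>q\<in>D. t < q \<and> z \<in> F q)" for t z
    unfolding f_def by (subst less_cSup_iff[OF _ bdd]) auto
  have f_ge0: "0 \<le> f z" and f_ge: "q \<in> D \<Longrightarrow> z \<in> F q \<Longrightarrow> q \<le> f z" for z q
    unfolding f_def using bdd by (auto intro: cSup_upper)
  have f_le1: "f z \<le> 1" for z
    unfolding f_def using D(1) by (intro cSup_least) auto
  have f_le: "f z \<le> q" if "q \<in> D" "z \<notin> F q" for q z
    unfolding f_def
  proof (rule cSup_least)
    fix r
    assume "r \<in> insert 0 {q \<in> D. z \<in> F q}"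
    then show "r \<le> q"
      using that mono[of q r] D(1) by (cases "q \<le> r") auto
  qed simp
  have f_less: "f z < t \<longleftrightarrow> 1 < t \<or> (\<exists>q\<in>D. q < t \<and> z \<notin> F q)" for t z
  proof
    assume ft: "f z < t"
    show "1 < t \<or> (\<exists>q\<in>D. q < t \<and> z \<notin> F q)"
    proof (cases "1 < t")
      case False
      then obtain q where "q \<in> D" "f z < q" "q < t"
        using D(2)[OF f_ge0 ft] by auto
      then show ?thesis
        using f_ge[of q z] by fastforce
    qed simp
  qed (use f_le f_le1 in \<open>fastforce intro: le_less_trans\<close>)
  show ?thesis
  proof
    have "open {z. t < f z}" for t
    proof (subst open_subopen, intro ballI)
      fix z
      assume z: "z \<in> {z. t < f z}"
      show "\<exists>T. open T \<and> z \<in> T \<and> T \<subseteq> {z. t < f z}"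
      proof (cases "t < 0")
        case True
        then show ?thesis by (intro exI[of _ UNIV]) (simp add: f_greater)
      next
        case False
        with z obtain r where r: "r \<in> D" "t < r" "z \<in> F r"
          by (auto simp: f_greater)
        obtain q where q: "q \<in> D" "t < q" "q < r"
          using D(2)[of t r] False r D(1) by fastforce
        have "{z. t < f z} \<supseteq> interior (F q)"
          using q interior_subset by (auto simp: f_greater)
        then show ?thesis
          using nested[OF q(1) r(1) q(3)] r(3) by (intro exI[of _ "interior (F q)"]) auto
      qed
    qed
    moreover have "open {z. f z < t}" for t
    proof -
      have "{z. f z < t} = {z. 1 < t} \<union> (\<Union>q\<in>{q\<in>D. q < t}. - F q)"
        by (auto simp: f_less)
      then show ?thesis
        using closed by (auto intro!: open_Un open_UN simp: open_Compl)
    qed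
    ultimately show "continuous_on UNIV f"
      by (intro continuous_on_generate_topology[OF open_generated_order])
        (auto simp: vimage_def)
    show "range f \<subseteq> {0..1}"
      using f_ge0 f_le1 by auto
    show "f (m a b) = min (f a) (f b)" for a b
    proof -
      have "t < f (m a b) \<longleftrightarrow> t < f a \<and> t < f b" for t
      proof
        assume "t < f a \<and> t < f b"
        moreover have "\<exists>q\<in>D. t < q \<and> m a b \<in> F q"
          if "q \<in> D" "r \<in> D" "t < q" "t < r" "a \<in> F q" "b \<in> F r" for q r
        proof (cases "q \<le> r")
          case True
          then show ?thesis
            using that mono[of q r] filter[of q a b] by blast
        next
          case False
          then show ?thesis
            using that mono[of r q] filter[of r a b] by fastforce
        qed
        ultimately show "t < f (m a b)"
          unfolding f_greater by blast
      qed (auto simp: f_greater filter)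
      then have "t < f (m a b) \<longleftrightarrow> t < min (f a) (f b)" for t
        by simp
      then show ?thesis
        by (metis less_irrefl linorder_neqE)
    qed
    show "f z = 1" if "\<And>q. q \<in> D \<Longrightarrow> z \<in> F q" for z
      using that f_less[of z 1] f_le1[of z] by fastforce
    show "f z = 0" if "\<And>q. q \<in> D \<Longrightarrow> z \<notin> F q" for z
      using that f_greater[of 0 z] f_ge0[of z] by fastforce
  qed
qed

lemma dyadics_dense_unit_interval:
  fixes s t :: real
  assumes "0 \<le> s" "s < t" "t \<le> 1"
  shows "\<exists>q\<in>dyadics \<inter> {0..1}. s < q \<and> q < t"
proof -
  have "closure ({s<..<t} \<inter> dyadics) = closure {s<..<t}"
    unfolding dyadics_def
    using assms by (intro closure_dyadic_rationals_in_convex_set_pos_1) auto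
  then have "{s<..<t} \<inter> dyadics \<noteq> {}"
    using assms by auto
  then show ?thesis
    using assms by fastforce
qed

context separately_continuous_semilattice
begin

lemma way_below_homomorphism:
  assumes locally_minorized "v \<lless> x" "y \<notin> upper_set m v"
  obtains f :: "'a \<Rightarrow> real" where "continuous_on UNIV f" "range f \<subseteq> {0..1}"
    "\<And>a b. f (m a b) = min (f a) (f b)" "f x = 1" "f y = 0"
proof -
  define D :: "real set" where "D = dyadics \<inter> {0..1}"
  have "\<exists>g :: real \<Rightarrow> 'a. g 0 = v \<and> g 1 = x \<and>
      (\<forall>q\<in>dyadics \<inter> {0..1}. \<forall>r\<in>dyadics \<inter> {0..1}. q < r \<longrightarrow> g q \<lless> g r)"
    by (rule recursion_on_dyadic_fractions)
      (fact assms(2) way_below_interpolate[OF assms(1)] way_below_trans)+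
  then obtain g :: "real \<Rightarrow> 'a" where g: "g 0 = v" "g 1 = x"
      "\<And>q r. q \<in> D \<Longrightarrow> r \<in> D \<Longrightarrow> q < r \<Longrightarrow> g q \<lless> g r"
    unfolding D_def by blast
  have ends: "0 \<in> D" "1 \<in> D"
    using real_in_dyadics[of 0] real_in_dyadics[of 1] by (auto simp: D_def)
  have le: "g r \<in> upper_set m (g q)" if "q \<in> D" "r \<in> D" "q \<le> r" for q r
    using g(3)[OF that(1,2)] that(3) way_below_imp_in_upper_set self_in_upper_set
    by (cases "q = r") auto
  show ?thesis
  proof (rule nested_filters_homomorphism[of D "\<lambda>q. upper_set m (g q)" m])
    show "D \<subseteq> {0..1}"
      by (simp add: D_def)
    show "\<exists>q\<in>D. s < q \<and> q < t" if "0 \<le> s" "s < t" "t \<le> 1" for s t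
      unfolding D_def using that by (rule dyadics_dense_unit_interval)
    show "closed (upper_set m (g q))" for q
      by (rule closed_upper_set)
    show "m a b \<in> upper_set m (g q) \<longleftrightarrow> a \<in> upper_set m (g q) \<and> b \<in> upper_set m (g q)"
      for q a b
      by (rule upper_set_mult_iff)
    show "upper_set m (g r) \<subseteq> interior (upper_set m (g q))"
      if "q \<in> D" "r \<in> D" "q < r" for q r
      using g(3)[OF that] by (rule way_below_upper_set_subset_interior)
  next
    fix f :: "'a \<Rightarrow> real"
    assume f: "continuous_on UNIV f" "range f \<subseteq> {0..1}"
      "\<And>a b. f (m a b) = min (f a) (f b)"
      "\<And>z. (\<And>q. q \<in> D \<Longrightarrow> z \<in> upper_set m (g q)) \<Longrightarrow> f z = 1"
      "\<And>z. (\<And>q. q \<in> D \<Longrightarrow> z \<notin> upper_set m (g q)) \<Longrightarrow> f z = 0"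
    have "x \<in> upper_set m (g q)" if "q \<in> D" for q
      using le[OF that ends(2)] that g(2) by (simp add: D_def)
    then have "f x = 1"
      by (rule f(4))
    have "y \<notin> upper_set m (g q)" if "q \<in> D" for q
    proof -
      have "upper_set m (g q) \<subseteq> upper_set m v"
        using le[OF ends(1) that] that g(1) by (intro upper_set_antimono) (simp add: D_def)
      then show ?thesis
        using assms(3) by blast
    qed
    then have "f y = 0"
      by (rule f(5))
    show thesis
      by (rule that) fact+
  qed
qed

lemma locally_minorized_imp_I_separated:
  assumes locally_minorized
  shows "I_separated m"
  unfolding I_separated_def
proof (intro allI impI)
  fix x y :: 'a
  assume "x \<noteq> y"
  have hom: "\<exists>f :: 'a \<Rightarrow> real. continuous_on UNIV f \<and> range f \<subseteq> {0..1} \<and>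
      (\<forall>a b. f (m a b) = min (f a) (f b)) \<and> f p \<noteq> f q" if pq: "q \<notin> upper_set m p" for p q
  proof -
    obtain v where "v \<lless> p" "q \<notin> upper_set m v"
      using separation_by_way_below[OF assms pq] by blast
    then show ?thesis
      by (rule way_below_homomorphism[OF assms]) (metis zero_neq_one)
  qed
  have "y \<notin> upper_set m x \<or> x \<notin> upper_set m y"
    using \<open>x \<noteq> y\<close> upper_set_antisym by blast
  then show "\<exists>f :: 'a \<Rightarrow> real. continuous_on UNIV f \<and> range f \<subseteq> {0..1} \<and>
      (\<forall>a b. f (m a b) = min (f a) (f b)) \<and> f x \<noteq> f y"
    using hom[of y x] hom[of x y] by metis
qed

section \<open>Equivalence of the four conditions\<close>

lemma compact_I_separated_imp_Lawson:
  assumes "compact (UNIV :: 'a set)" "I_separated m"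
  shows "Lawson_semilattice m"
  unfolding Lawson_semilattice_def
proof (intro exI conjI)
  let ?B = "{W. open W \<and> subsemilattice m W}"
  show "topological_basis ?B"
  proof (rule topological_basisI)
    fix U and x :: 'a
    assume U: "open U" "x \<in> U"
    have "\<exists>W. (open W \<and> subsemilattice m W \<and> x \<in> W) \<and> W \<subseteq> U"
    proof (rule compact_separation_imp_small[OF assms(1) U(1)])
      fix y
      assume "y \<notin> U"
      with U(2) show "\<exists>W. (open W \<and> subsemilattice m W \<and> x \<in> W) \<and> y \<notin> closure W"
        using I_separated_open_subsemilattice[OF assms(2), of x y] by blast
    qed (auto simp: subsemilattice_def)
    then show "\<exists>W\<in>?B. x \<in> W \<and> W \<subseteq> U"
      by blast
  qed simp
  show "\<forall>W\<in>?B. subsemilattice m W"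
    by simp
qed

end

theorem proposition2:
  fixes m :: "'a::t2_space \<Rightarrow> 'a \<Rightarrow> 'a"
  assumes "semitopological_semilattice m"
  shows "(Lawson_semilattice m \<longrightarrow> kappa_Lawson m (card_of {()})) \<and>
         (V_semilattice m \<longrightarrow> kappa_Lawson m (card_of {()})) \<and>
         (I_separated m \<longrightarrow> kappa_Lawson m (card_of {()})) \<and>
         (compact (UNIV :: 'a set) \<longrightarrow>
            (kappa_Lawson m (card_of {()}) \<longleftrightarrow> Lawson_semilattice m) \<and>
            (Lawson_semilattice m \<longleftrightarrow> V_semilattice m) \<and>
            (V_semilattice m \<longleftrightarrow> I_separated m))"
proof -
  have "semilattice m" "\<And>a. continuous_on UNIV (m a)"
    using assms by (auto simp: semitopological_semilattice_def)
  then interpret separately_continuous_semilattice m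
    by (intro separately_continuous_semilattice.intro
        separately_continuous_semilattice_axioms.intro)
  show ?thesis
    using Lawson_imp_one_Lawson V_imp_one_Lawson I_separated_imp_one_Lawson
      locally_minorized_if_compact locally_minorized_imp_V
      locally_minorized_imp_I_separated compact_I_separated_imp_Lawson
    by blast
qed

end
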